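(* Let $K\in\mathbb{R}^{n\times n}$ be a symmetric positive definite matrix, let $1\le k\le n$ be an integer, let $\mathcal{C}\sim kDPP(K)$, and let $\bm{u},\bm{w}\in\mathbb{R}^n$. Then $$\mathbb{E}_{C}\big[\bm{u}^\top C K_{\mathcal{C}\mathcal{C}}^{-1}C^\top \bm{w}\big] = \frac{e_k(K)-e_k(K-\bm{w}\bm{u}^\top)}{e_{k}(K)} =\frac{(-1)^{k+1}}{(n-k)!}\,\frac{\mathrm{d}^{\,n-k}}{\mathrm{d} t^{\,n-k}}\left[\frac{\bm{u}^\top \operatorname{adj}(t\mathbb{I}-K)\bm{w}}{e_k(K)}\right]_{t=0},$$ where $\operatorname{adj}$ denotes the adjugate of a matrix and $\mathbb{I}$ is the $n\times n$ identity matrix.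
   Context: Write $[n]=\{1,\dots,n\}$. For a subset $\mathcal{C}\subseteq[n]$, $C$ denotes the $n\times|\mathcal{C}|$ sampling matrix obtained by selecting the columns of the $n\times n$ identity matrix indexed by $\mathcal{C}$, and $K_{\mathcal{C}\mathcal{C}}=C^\top K C$ is the corresponding principal submatrix. For any square matrix $A\in\mathbb{R}^{n\times n}$ (not necessarily symmetric), $e_k(A)$ is defined through the characteristic polynomial by $\det(t\mathbb{I}-A)=\sum_{k=0}^{n}(-1)^{k}e_{k}(A)t^{n-k}$; equivalently, $e_k(A)$ is the $k$-th elementary symmetric polynomial of the eigenvalues of $A$ (counted with algebraic multiplicity). $kDPP(K)$ is the probability distribution on subsets $\mathcal{C}\subseteq[n]$ of fixed size $|\mathcal{C}|=k$ given by $\Pr(Y=\mathcal{C})=\det(K_{\mathcal{C}\mathcal{C}})/e_k(K)$. The expectation $\mathbb{E}_C$ is over the random subset $\mathcal{C}$ (equivalently, over its sampling matrix $C$). *)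

theory Defs
  imports
    "HOL-Probability.Probability_Mass_Function"
    "Jordan_Normal_Form.Char_Poly"
    "Jordan_Normal_Form.Gauss_Jordan_Elimination"
    "Jordan_Normal_Form.DL_Submatrix"
begin

(* HOL-Analysis and Jordan_Normal_Form reuse the same notation and names;
   below, vectors and matrices are those of Jordan_Normal_Form. *)
no_notation Finite_Cartesian_Product.vec_nth (infixl \<open>$\<close> 90)
no_notation real_inner_class.inner (infix \<open>\<bullet>\<close> 70)
hide_type (open) Finite_Cartesian_Product.vec
hide_const (open) Finite_Cartesian_Product.mat Finite_Cartesian_Product.vec
  Determinants.det

(* The index set [n] is rendered as {..<n}, the index range of n x n matrices here. *)

definition sym_pos_def :: "nat \<Rightarrow> real mat \<Rightarrow> bool" where
  "sym_pos_def n K \<longleftrightarrow> K \<in> carrier_mat n n \<and> K\<^sup>T = K \<and>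
     (\<forall>x \<in> carrier_vec n. x \<noteq> 0\<^sub>v n \<longrightarrow> x \<bullet> (K *\<^sub>v x) > 0)"

(* From det (t I - A) = (\<Sum>k\<le>n. (-1)^k * e_k(A) * t^(n-k)) for A of size n;
   only meaningful for k \<le> n, since subtraction on nat truncates. *)
definition e_coeff :: "nat \<Rightarrow> 'a :: comm_ring_1 mat \<Rightarrow> 'a" where
  "e_coeff k A = (-1) ^ k * poly.coeff (char_poly A) (dim_row A - k)"

(* The columns of the identity indexed by S, in increasing order of index. *)
definition sampling_mat :: "nat \<Rightarrow> nat set \<Rightarrow> 'a :: {zero,one} mat" where
  "sampling_mat n S = submatrix (1\<^sub>m n) UNIV S"

definition principal_submat :: "'a :: comm_ring_1 mat \<Rightarrow> nat set \<Rightarrow> 'a mat" where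
  "principal_submat K S =
     (sampling_mat (dim_row K) S)\<^sup>T * K * sampling_mat (dim_row K) S"

(* Unspecified for singular matrices. *)
definition inv_mat :: "'a :: field mat \<Rightarrow> 'a mat" where
  "inv_mat A = the (mat_inverse A)"

definition outer_prod :: "'a :: times vec \<Rightarrow> 'a vec \<Rightarrow> 'a mat" where
  "outer_prod w u = mat (dim_vec w) (dim_vec u) (\<lambda>(i, j). w $ i * u $ j)"

(* embed_pmf is characterised by these point masses only when they are nonnegative
   and sum to 1, which is the case for K symmetric positive definite and
   k \<le> dim_row K. *)
definition kDPP :: "nat \<Rightarrow> real mat \<Rightarrow> nat set pmf" where
  "kDPP k K = embed_pmf (\<lambda>S.
     if S \<subseteq> {..<dim_row K} \<and> card S = k
     then det (principal_submat K S) / e_coeff k K else 0)"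

end

theory Submission
  imports Defs
begin

text \<open>
  Expanding \<open>det (t I - A)\<close> along the diagonal shows that \<open>e\<^sub>k(A)\<close> is the sum of the \<open>k \<times> k\<close>
  principal minors of \<open>A\<close>. The matrix determinant lemma
  \<open>det (A - w u\<^sup>T) = det A - u\<^sup>T adj(A) w\<close>, applied to each principal submatrix of \<open>K\<close>, turns
  \<open>e\<^sub>k(K) - e\<^sub>k(K - w u\<^sup>T)\<close> into the sum of the terms of the expectation; applied to
  \<open>t I - K\<close>, it identifies \<open>u\<^sup>T adj(t I - K) w\<close> with the difference of the characteristic
  polynomials of \<open>K - w u\<^sup>T\<close> and \<open>K\<close>, whose coefficient of \<open>t\<^bsup>n-k\<^esup>\<close> is read off by
  differentiating at \<open>0\<close>.
\<close>

section \<open>Principal submatrices and the Leibniz formula over index subsets\<close>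

text \<open>Conjugation by \<open>f\<close> turns permutations of \<open>{..<m}\<close> into
  permutations of \<open>S\<close> and preserves the sign. The Leibniz sum of a principal submatrix
  can thus run over permutations of \<open>S\<close> itself.\<close>

lemma det_sum_permutes_reindex:
  assumes f: "bij_betw f {..<m} S" and A: "A \<in> carrier_mat m m"
    and entry: "\<And>i j. i < m \<Longrightarrow> j < m \<Longrightarrow> A $$ (i, j) = g (f i) (f j)"
  shows "det A = (\<Sum>p | p permutes S. signof p * (\<Prod>i\<in>S. g i (p i)))"
proof -
  let ?h = "map_permutation {..<m} f"
  let ?h' = "map_permutation S (inv_into {..<m} f)"
  have inj: "inj_on f {..<m}" and S: "f ` {..<m} = S"
    using f by (auto simp: bij_betw_def)
  have f': "bij_betw (inv_into {..<m} f) S {..<m}"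
    by (rule bij_betw_inv_into[OF f])
  have "det A = (\<Sum>p | p permutes {..<m}. signof p * (\<Prod>i<m. A $$ (i, p i)))"
    unfolding det_def'[OF A] by (simp add: atLeast0LessThan)
  also have "\<dots> = (\<Sum>p | p permutes S. signof p * (\<Prod>i\<in>S. g i (p i)))"
  proof (rule sum.reindex_bij_witness[where i = ?h' and j = ?h])
    fix p assume "p \<in> {p. p permutes {..<m}}"
    then have p: "p permutes {..<m}" by simp
    show "?h' (?h p) = p"
      by (rule map_permutation_compose_inv[OF f p]) (use inj in auto)
    show "?h p \<in> {p. p permutes S}"
      using map_permutation_permutes[OF f p] by simp
    have "(\<Prod>i\<in>S. g i (?h p i)) = (\<Prod>i<m. g (f i) (?h p (f i)))"
      using prod.reindex_bij_betw[OF f, of "\<lambda>i. g i (?h p i)"] by simp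
    also have "\<dots> = (\<Prod>i<m. A $$ (i, p i))"
      using permutes_in_image[OF p] by (intro prod.cong) (auto simp: map_permutation_apply[OF inj] entry)
    finally show "signof (?h p) * (\<Prod>i\<in>S. g i (?h p i)) = signof p * (\<Prod>i<m. A $$ (i, p i))"
      by (simp add: sign_map_permutation[OF inj p])
  next
    fix p assume "p \<in> {p. p permutes S}"
    then have p: "p permutes S" by simp
    show "?h (?h' p) = p"
      by (rule map_permutation_compose_inv[OF f' p]) (use S in \<open>auto intro: f_inv_into_f\<close>)
    show "?h' p \<in> {p. p permutes {..<m}}"
      using map_permutation_permutes[OF f' p] by simp
  qed
  finally show ?thesis .
qed

text \<open>Strict monotonicity of \<open>pick S\<close> gives injectivity; counting then gives
  surjectivity.\<close>

lemma bij_betw_pick: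
  assumes "finite S"
  shows "bij_betw (pick S) {..<card S} S"
proof -
  have inj: "inj_on (pick S) {..<card S}"
  proof (rule linorder_inj_onI')
    show "pick S i \<noteq> pick S j" if "j \<in> {..<card S}" "i < j" for i j
      using pick_mono_le[of j S i] that by simp
  qed
  moreover have "pick S ` {..<card S} = S"
    by (rule card_subset_eq[OF assms]) (auto simp: card_image[OF inj] pick_in_set_le)
  ultimately show ?thesis by (simp add: bij_betw_def)
qed

lemma sampling_mat_carrier:
  assumes "S \<subseteq> {..<n}"
  shows "sampling_mat n S \<in> carrier_mat n (card S)"
proof -
  have "{j. j < n \<and> j \<in> S} = S" using assms by auto
  then show ?thesis
    unfolding sampling_mat_def by (intro carrier_matI) (simp_all add: dim_submatrix)
qed

lemma sampling_mat_index:
  assumes "S \<subseteq> {..<n}" "i < n" "j < card S"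
  shows "sampling_mat n S $$ (i, j) = (if i = pick S j then 1 else 0)"
proof -
  have "{j. j < n \<and> j \<in> S} = S" using assms(1) by auto
  moreover have "pick S j < n" using pick_in_set_le[OF assms(3)] assms(1) by auto
  ultimately show ?thesis
    using assms unfolding sampling_mat_def by (simp add: submatrix_index pick_UNIV)
qed

text \<open>Row \<open>i\<close> of the transpose is the unit vector at \<open>pick S i\<close>.
  Used once for columns and once for rows, this yields the entries of a principal submatrix.\<close>

lemma transpose_sampling_mat_mult_vec:
  fixes v :: "'a :: comm_ring_1 vec"
  assumes S: "S \<subseteq> {..<n}" and v: "v \<in> carrier_vec n"
  shows "(sampling_mat n S)\<^sup>T *\<^sub>v v = vec (card S) (\<lambda>i. v $ pick S i)"
proof (rule eq_vecI)
  let ?C = "sampling_mat n S :: 'a mat"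
  note C = sampling_mat_carrier[OF S, where 'a = 'a]
  show "dim_vec (?C\<^sup>T *\<^sub>v v) = dim_vec (vec (card S) (\<lambda>i. v $ pick S i))"
    using C by simp
  fix i assume "i < dim_vec (vec (card S) (\<lambda>i. v $ pick S i))"
  then have i: "i < card S" by simp
  have pick: "pick S i < n" using pick_in_set_le[OF i] S by auto
  have "(?C\<^sup>T *\<^sub>v v) $ i = (\<Sum>l\<in>{0..<n}. ?C $$ (l, i) * v $ l)"
    using C i v by (simp add: scalar_prod_def)
  also have "\<dots> = (\<Sum>l\<in>{0..<n}. if l = pick S i then v $ l else 0)"
    using i by (intro sum.cong) (auto simp: sampling_mat_index[OF S])
  also have "\<dots> = v $ pick S i"
    using pick by simp
  finally show "(?C\<^sup>T *\<^sub>v v) $ i = vec (card S) (\<lambda>i. v $ pick S i) $ i"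
    using i by simp
qed

lemma principal_submat_carrier:
  assumes "A \<in> carrier_mat n n" "S \<subseteq> {..<n}"
  shows "principal_submat A S \<in> carrier_mat (card S) (card S)"
  using sampling_mat_carrier[OF assms(2), where 'a = 'a] assms(1)
  unfolding principal_submat_def by auto

lemma principal_submat_index:
  fixes A :: "'a :: comm_ring_1 mat"
  assumes A: "A \<in> carrier_mat n n" and S: "S \<subseteq> {..<n}" and i: "i < card S" and j: "j < card S"
  shows "principal_submat A S $$ (i, j) = A $$ (pick S i, pick S j)"
proof -
  let ?C = "sampling_mat n S :: 'a mat"
  note C = sampling_mat_carrier[OF S, where 'a = 'a]
  have pick: "pick S l < n" if "l < card S" for l using pick_in_set_le[OF that] S by auto
  have CA: "?C\<^sup>T * A \<in> carrier_mat (card S) n" using C A by auto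
  have col: "(?C\<^sup>T * A) $$ (i, l) = A $$ (pick S i, l)" if "l < n" for l
  proof -
    have "(?C\<^sup>T * A) $$ (i, l) = (?C\<^sup>T *\<^sub>v col A l) $ i"
      using C A i that by simp
    then show ?thesis
      using A i that pick[OF i] by (simp add: transpose_sampling_mat_mult_vec[OF S, of "col A l"])
  qed
  have "principal_submat A S $$ (i, j) = row (?C\<^sup>T * A) i \<bullet> col ?C j"
    unfolding principal_submat_def carrier_matD(1)[OF A]
    by (rule index_mult_mat(1)) (use C CA i j in simp_all)
  also have "\<dots> = (?C\<^sup>T *\<^sub>v row (?C\<^sup>T * A) i) $ j"
    using C CA i j by (simp add: comm_scalar_prod[of _ n])
  also have "\<dots> = A $$ (pick S i, pick S j)"
    using CA i j pick[OF j] col[OF pick[OF j]]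
    by (simp add: transpose_sampling_mat_mult_vec[OF S, of "row (?C\<^sup>T * A) i"] del: index_mult_mat)
  finally show ?thesis .
qed

lemma det_principal_submat:
  fixes A :: "'a :: comm_ring_1 mat"
  assumes A: "A \<in> carrier_mat n n" and S: "S \<subseteq> {..<n}"
  shows "det (principal_submat A S) = (\<Sum>p | p permutes S. signof p * (\<Prod>i\<in>S. A $$ (i, p i)))"
  using bij_betw_pick[OF finite_subset[OF S finite_lessThan]] principal_submat_carrier[OF A S]
  by (rule det_sum_permutes_reindex) (rule principal_submat_index[OF A S])

section \<open>Characteristic coefficients as sums of principal minors\<close>

text \<open>In the Leibniz expansion each factor is an entry of \<open>- A\<close>, plus the
  variable if \<open>i\<close> is a fixed point of \<open>p\<close>. Let \<open>S\<close> be the set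
  of positions that contribute the entry. A term survives only if \<open>p\<close> fixes the
  complement of \<open>S\<close>, that is, if \<open>p\<close> permutes \<open>S\<close>; the
  surviving terms add up to the signed minor on \<open>S\<close> times a power of the
  variable.\<close>

lemma char_poly_principal_minors:
  fixes A :: "'a :: comm_ring_1 mat"
  assumes A: "A \<in> carrier_mat n n"
  shows "char_poly A =
    (\<Sum>S\<in>Pow {..<n}. monom ((-1) ^ card S * det (principal_submat A S)) (n - card S))"
proof -
  let ?P = "{p. p permutes {..<n}}"
  let ?a = "\<lambda>p i. [:- A $$ (i, p i):]"
  let ?x = "\<lambda>p i. if p i = i then [:0, 1:] else (0 :: 'a poly)"
  have minor: "(\<Sum>p\<in>?P. signof p * (prod (?a p) S * prod (?x p) ({..<n} - S)))
      = monom ((-1) ^ card S * det (principal_submat A S)) (n - card S)"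
    if S: "S \<subseteq> {..<n}" for S
  proof -
    have fin: "finite S" using S finite_subset by blast
    have "(\<Sum>p\<in>?P. signof p * (prod (?a p) S * prod (?x p) ({..<n} - S)))
        = (\<Sum>p | p permutes S. signof p * (prod (?a p) S * prod (?x p) ({..<n} - S)))"
    proof (rule sum.mono_neutral_right)
      show "finite ?P" by (simp add: finite_permutations)
      show "{p. p permutes S} \<subseteq> ?P" using S by (auto intro: permutes_subset)
      show "\<forall>p\<in>?P - {p. p permutes S}. signof p * (prod (?a p) S * prod (?x p) ({..<n} - S)) = 0"
      proof
        fix p assume p: "p \<in> ?P - {p. p permutes S}"
        obtain i where "i \<in> {..<n} - S" "p i \<noteq> i"
          using p permutes_superset[of p "{..<n}" S] by auto
        then have "prod (?x p) ({..<n} - S) = 0" by (intro prod_zero) auto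
        then show "signof p * (prod (?a p) S * prod (?x p) ({..<n} - S)) = 0" by simp
      qed
    qed
    also have "\<dots> = (\<Sum>p | p permutes S.
        monom ((-1) ^ card S * (signof p * (\<Prod>i\<in>S. A $$ (i, p i)))) (n - card S))"
    proof (rule sum.cong[OF refl])
      fix p assume "p \<in> {p. p permutes S}"
      then have p: "p permutes S" by simp
      have "prod (?x p) ({..<n} - S) = (\<Prod>i\<in>{..<n} - S. [:0, 1:])"
        using p by (intro prod.cong) (auto simp: permutes_not_in)
      also have "\<dots> = monom 1 (n - card S)"
        using S fin by (simp add: card_Diff_subset monom_altdef)
      finally have 1: "prod (?x p) ({..<n} - S) = monom 1 (n - card S)" .
      have "prod (?a p) S = [:\<Prod>i\<in>S. - A $$ (i, p i):]"
        using fin by (induction S rule: finite_induct) (auto simp: one_pCons)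
      also have "(\<Prod>i\<in>S. - A $$ (i, p i)) = (-1) ^ card S * (\<Prod>i\<in>S. A $$ (i, p i))"
        by (simp flip: prod_uminus)
      finally have 2: "prod (?a p) S = [:(-1) ^ card S * (\<Prod>i\<in>S. A $$ (i, p i)):]" .
      show "signof p * (prod (?a p) S * prod (?x p) ({..<n} - S)) =
          monom ((-1) ^ card S * (signof p * (\<Prod>i\<in>S. A $$ (i, p i)))) (n - card S)"
        \<comment> \<open>The sign is a polynomial on the left and a scalar inside
          \<open>monom\<close> on the right; splitting into the values 1 and -1 reconciles the
          two.\<close>
        unfolding 1 2 by (cases p rule: sign_cases) (simp_all add: smult_monom minus_monom)
    qed
    also have "\<dots> = monom ((-1) ^ card S * det (principal_submat A S)) (n - card S)"
      unfolding det_principal_submat[OF A S] sum_distrib_left by (simp add: monom_sum)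
    finally show ?thesis .
  qed
  have "char_poly A = (\<Sum>p\<in>?P. signof p * (\<Prod>i<n. char_poly_matrix A $$ (i, p i)))"
    unfolding char_poly_def det_def'[OF char_poly_matrix_closed[OF A]]
    by (simp add: atLeast0LessThan)
  also have "\<dots> = (\<Sum>p\<in>?P. signof p * (\<Prod>i<n. ?a p i + ?x p i))"
  proof (intro sum.cong refl arg_cong2[where f = "(*)"] prod.cong)
    fix p i assume "p \<in> ?P" "i \<in> {..<n}"
    then have "i < n" "p i < n" using permutes_in_image[of p "{..<n}" i] by auto
    then show "char_poly_matrix A $$ (i, p i) = ?a p i + ?x p i"
      using A by (auto simp: char_poly_matrix_def)
  qed
  also have "\<dots> = (\<Sum>p\<in>?P. \<Sum>S\<in>Pow {..<n}. signof p * (prod (?a p) S * prod (?x p) ({..<n} - S)))"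
    by (simp only: prod_add[OF finite_lessThan] sum_distrib_left)
  also have "\<dots> = (\<Sum>S\<in>Pow {..<n}. \<Sum>p\<in>?P. signof p * (prod (?a p) S * prod (?x p) ({..<n} - S)))"
    by (rule sum.swap)
  also have "\<dots> = (\<Sum>S\<in>Pow {..<n}. monom ((-1) ^ card S * det (principal_submat A S)) (n - card S))"
    by (intro sum.cong refl minor) auto
  finally show ?thesis .
qed

lemma coeff_char_poly:
  assumes "A \<in> carrier_mat n n"
  shows "poly.coeff (char_poly A) (n - k) = (-1) ^ k * e_coeff k A"
  using assms unfolding e_coeff_def by (simp flip: mult.assoc power_add)

lemma e_coeff_principal_minors:
  fixes A :: "'a :: comm_ring_1 mat"
  assumes A: "A \<in> carrier_mat n n" and k: "k \<le> n"
  shows "e_coeff k A = (\<Sum>S | S \<subseteq> {..<n} \<and> card S = k. det (principal_submat A S))"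
proof -
  have "e_coeff k A = (\<Sum>S\<in>Pow {..<n}. (-1) ^ k * 
      poly.coeff (monom ((-1) ^ card S * det (principal_submat A S)) (n - card S)) (n - k))"
    using A unfolding e_coeff_def char_poly_principal_minors[OF A] coeff_sum by (simp add: sum_distrib_left)
  also have "\<dots> = (\<Sum>S\<in>Pow {..<n}. if card S = k then det (principal_submat A S) else 0)"
  proof (rule sum.cong[OF refl])
    fix S assume "S \<in> Pow {..<n}"
    then have "card S \<le> n" using card_mono[of "{..<n}" S] by auto
    \<comment> \<open>Truncated subtraction from \<open>n\<close> is injective here, as both
      \<open>card S\<close> and \<open>k\<close> are at most \<open>n\<close>.\<close>
    then have "n - card S = n - k \<longleftrightarrow> card S = k" using k by auto
    then show "(-1) ^ k * poly.coeff (monom ((-1) ^ card S * det (principal_submat A S)) (n - card S)) (n - k)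
        = (if card S = k then det (principal_submat A S) else 0)"
      by (auto simp flip: mult.assoc power_add)
  qed
  also have "\<dots> = (\<Sum>S | S \<subseteq> {..<n} \<and> card S = k. det (principal_submat A S))"
    by (simp add: sum.If_cases Int_def)
  finally show ?thesis .
qed

section \<open>Rank-one updates of determinants and characteristic polynomials\<close>

lemma outer_prod_carrier [simp]:
  "w \<in> carrier_vec n \<Longrightarrow> u \<in> carrier_vec m \<Longrightarrow> outer_prod w u \<in> carrier_mat n m"
  unfolding outer_prod_def by auto

lemma minus_outer_prod_carrier [simp]:
  "w \<in> carrier_vec n \<Longrightarrow> u \<in> carrier_vec m \<Longrightarrow> A - outer_prod w u \<in> carrier_mat n m"
  by (intro minus_carrier_mat outer_prod_carrier)

lemma det_minus_outer_prod_nonsingular: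
  fixes A :: "'a :: idom mat"
  assumes A: "A \<in> carrier_mat n n" and u: "u \<in> carrier_vec n" and w: "w \<in> carrier_vec n"
    and d: "det A \<noteq> 0"
  shows "det (A - outer_prod w u) = det A - u \<bullet> (adj_mat A *\<^sub>v w)"
proof -
  note adj = adj_mat[OF A]
  define U where "U = mat_of_rows n [u]"
  define W where "W = mat_of_cols n [w]"
  \<comment> \<open>Clear \<open>W\<close> from the bordered matrix \<open>B\<close> by row operations (\<open>L\<close>) and by column
    operations scaled by \<open>det A\<close> (\<open>R\<close>), and compare the two values of \<open>det B\<close>.\<close>
  define L where "L = four_block_mat (1\<^sub>m 1) (0\<^sub>m 1 n) (- W) (1\<^sub>m n)"
  define B where "B = four_block_mat (1\<^sub>m 1) U W A"
  define R where "R = four_block_mat (det A \<cdot>\<^sub>m 1\<^sub>m 1) (0\<^sub>m 1 n) (- (adj_mat A * W)) (1\<^sub>m n)"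
  have U: "U \<in> carrier_mat 1 n" unfolding U_def by (simp add: carrier_matI)
  have W: "W \<in> carrier_mat n 1" unfolding W_def by (simp add: carrier_matI)
  have aW: "adj_mat A * W \<in> carrier_mat n 1" using adj(1) W by simp
  have L: "L \<in> carrier_mat (1 + n) (1 + n)" and B: "B \<in> carrier_mat (1 + n) (1 + n)"
    and R: "R \<in> carrier_mat (1 + n) (1 + n)"
    unfolding L_def B_def R_def using A U W aW by auto
  have "L * B = four_block_mat (1\<^sub>m 1) U (0\<^sub>m n 1) (A - outer_prod w u)"
  proof -
    have "L * B = four_block_mat (1\<^sub>m 1 * 1\<^sub>m 1 + 0\<^sub>m 1 n * W) (1\<^sub>m 1 * U + 0\<^sub>m 1 n * A)
        (- W * 1\<^sub>m 1 + 1\<^sub>m n * W) (- W * U + 1\<^sub>m n * A)"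
      unfolding L_def B_def using A U W by (intro mult_four_block_mat) auto
    moreover have "- W * U + 1\<^sub>m n * A = A - outer_prod w u"
      using A u w unfolding W_def U_def outer_prod_def 
      by (intro eq_matI) (auto simp: mat_of_rows_def mat_of_cols_def scalar_prod_def)
    moreover have "- W * 1\<^sub>m 1 + 1\<^sub>m n * W = 0\<^sub>m n 1"
      using W by (intro eq_matI) auto
    ultimately show ?thesis using A U W by simp
  qed
  then have "det (L * B) = det (A - outer_prod w u)"
    using U u w by (simp add: det_four_block_mat_lower_left_zero[where n = 1 and m = n])
  moreover have "det L = 1"
    unfolding L_def using W by (subst det_four_block_mat_upper_right_zero[where n = 1 and m = n]) auto
  ultimately have 1: "det B = det (A - outer_prod w u)"
    by (simp add: det_mult[OF L B])
  have "B * R = four_block_mat (det A \<cdot>\<^sub>m 1\<^sub>m 1 - U * (adj_mat A * W)) U (0\<^sub>m n 1) A"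
  proof -
    have "B * R = four_block_mat (1\<^sub>m 1 * (det A \<cdot>\<^sub>m 1\<^sub>m 1) + U * - (adj_mat A * W)) (1\<^sub>m 1 * 0\<^sub>m 1 n + U * 1\<^sub>m n)
        (W * (det A \<cdot>\<^sub>m 1\<^sub>m 1) + A * - (adj_mat A * W)) (W * 0\<^sub>m 1 n + A * 1\<^sub>m n)"
      unfolding B_def R_def using A U W aW by (intro mult_four_block_mat) auto
    moreover have "W * (det A \<cdot>\<^sub>m 1\<^sub>m 1) + A * - (adj_mat A * W) = 0\<^sub>m n 1"
    proof -
      have "A * (adj_mat A * W) = (det A \<cdot>\<^sub>m 1\<^sub>m n) * W"
        using A adj W by (metis assoc_mult_mat)
      also have "\<dots> = det A \<cdot>\<^sub>m W"
        using W by (simp add: mult_smult_assoc_mat[of _ n n _ 1])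
      finally have "A * - (adj_mat A * W) = - (det A \<cdot>\<^sub>m W)"
        using uminus_mult_right_mat[of A "adj_mat A * W"] A adj(1) by simp
      moreover have "W * (det A \<cdot>\<^sub>m 1\<^sub>m 1) = det A \<cdot>\<^sub>m W"
        using W by (simp add: mult_smult_distrib[of _ n 1 _ 1])
      ultimately show ?thesis using W by (intro eq_matI) auto
    qed
    moreover have "1\<^sub>m 1 * (det A \<cdot>\<^sub>m 1\<^sub>m 1) + U * - (adj_mat A * W) = det A \<cdot>\<^sub>m 1\<^sub>m 1 - U * (adj_mat A * W)"
      using U aW by (intro eq_matI) auto
    ultimately show ?thesis using A U W by simp
  qed
  then have "det (B * R) = det (det A \<cdot>\<^sub>m 1\<^sub>m 1 - U * (adj_mat A * W)) * det A"
    using A U aW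
    by (simp add: det_four_block_mat_lower_left_zero[where n = 1 and m = n] minus_carrier_mat)
  also have "det (det A \<cdot>\<^sub>m 1\<^sub>m 1 - U * (adj_mat A * W)) = det A - u \<bullet> (adj_mat A *\<^sub>v w)"
  proof -
    have "col (adj_mat A * W) 0 = adj_mat A *\<^sub>v w"
      using adj(1) W w unfolding W_def by (subst col_mult2[of _ n n _ 1]) auto
    moreover have "row U 0 = u"
      using u unfolding U_def by simp
    ultimately show ?thesis
      using U aW by (subst det_single) (auto simp: minus_carrier_mat)
  qed
  also have "det (B * R) = det B * det A"
    unfolding det_mult[OF B R] unfolding R_def using aW
    by (subst det_four_block_mat_upper_right_zero[where n = 1 and m = n]) auto
  \<comment> \<open>Both values of \<open>det (B * R)\<close> contain the factor
    \<open>det A\<close>, which cancels in an integral domain because it is nonzero.\<close>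
  finally show ?thesis using 1 d by simp
qed

text \<open>Evaluation at \<open>x\<close> is a ring homomorphism, so it commutes with the minors
  that make up the adjugate.\<close>

lemma poly_adj_mat:
  assumes A: "A \<in> carrier_mat n n" and P: "P \<in> carrier_mat n n"
    and poly: "\<And>i j. i < n \<Longrightarrow> j < n \<Longrightarrow> poly (P $$ (i, j)) x = A $$ (i, j)"
    and i: "i < n" and j: "j < n"
  shows "poly (adj_mat P $$ (i, j)) x = adj_mat A $$ (i, j)"
proof -
  have "poly (det (mat_delete P j i)) x = det (mat_delete A j i)"
    by (rule poly_det_cong[OF mat_delete_carrier[OF A] mat_delete_carrier[OF P]])
      (use A P poly in \<open>auto simp: mat_delete_def\<close>)
  then show ?thesis
    using A P i j unfolding adj_mat_def cofactor_def by simp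
qed

lemma det_minus_outer_prod:
  fixes A :: "'a :: idom mat"
  assumes A: "A \<in> carrier_mat n n" and u: "u \<in> carrier_vec n" and w: "w \<in> carrier_vec n"
  shows "det (A - outer_prod w u) = det A - u \<bullet> (adj_mat A *\<^sub>v w)"
proof -
  \<comment> \<open>\<open>A\<close> may be singular, but \<open>X I + A\<close> is not; the identity for it is evaluated at \<open>X = 0\<close>.\<close>
  let ?P = "char_poly_matrix (- A)"
  let ?c = "map_vec (\<lambda>a. [:a:])"
  have A': "- A \<in> carrier_mat n n" using A by simp
  note P = char_poly_matrix_closed[OF A']
  have eval: "poly (?P $$ (i, j)) 0 = A $$ (i, j)" if "i < n" "j < n" for i j
    using A that by (auto simp: char_poly_matrix_def)
  \<comment> \<open>This determinant is the characteristic polynomial of \<open>- A\<close>, which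
    is monic and hence nonzero.\<close>
  have "det ?P \<noteq> 0"
    using degree_monic_char_poly[OF A'] unfolding char_poly_def by auto
  then have "poly (det (?P - outer_prod (?c w) (?c u))) 0 
      = poly (det ?P - ?c u \<bullet> (adj_mat ?P *\<^sub>v ?c w)) 0"
    using P u w by (subst det_minus_outer_prod_nonsingular[of _ n]) auto
  moreover have "poly (det (?P - outer_prod (?c w) (?c u))) 0 = det (A - outer_prod w u)"
    by (rule poly_det_cong[of _ n]) (use A P u w eval in \<open>auto simp: outer_prod_def\<close>)
  moreover have "poly (det ?P) 0 = det A"
    by (rule poly_det_cong[OF A P eval])
  moreover have "poly (?c u \<bullet> (adj_mat ?P *\<^sub>v ?c w)) 0 = u \<bullet> (adj_mat A *\<^sub>v w)"
    using u w adj_mat(1)[OF A] adj_mat(1)[OF P]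
    by (simp add: scalar_prod_def poly_sum poly_adj_mat[OF A P eval] mult.commute)
  ultimately show ?thesis by simp
qed

lemma poly_char_poly:
  assumes A: "A \<in> carrier_mat n n"
  shows "poly (char_poly A) x = det (x \<cdot>\<^sub>m 1\<^sub>m n - A)"
  unfolding char_poly_def
  by (rule poly_det_cong[of _ n]) (use A in \<open>auto simp: char_poly_matrix_def\<close>)

text \<open>Subtracting the update from \<open>A\<close> adds it to \<open>x I - A\<close>, so the
  determinant lemma is applied with \<open>- w\<close> in place of \<open>w\<close>; this accounts
  for the plus sign.\<close>

lemma char_poly_minus_outer_prod:
  fixes A :: "'a :: idom mat"
  assumes A: "A \<in> carrier_mat n n" and u: "u \<in> carrier_vec n" and w: "w \<in> carrier_vec n"
  shows "poly (char_poly (A - outer_prod w u)) x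
    = poly (char_poly A) x + u \<bullet> (adj_mat (x \<cdot>\<^sub>m 1\<^sub>m n - A) *\<^sub>v w)"
proof -
  let ?M = "x \<cdot>\<^sub>m 1\<^sub>m n - A"
  have M: "?M \<in> carrier_mat n n" using A by (rule minus_carrier_mat)
  have "x \<cdot>\<^sub>m 1\<^sub>m n - (A - outer_prod w u) = ?M - outer_prod (- w) u"
    using A u w by (intro eq_matI) (auto simp: outer_prod_def)
  then have "poly (char_poly (A - outer_prod w u)) x = det (?M - outer_prod (- w) u)"
    using A u w by (subst poly_char_poly[of _ n]) auto
  also have "\<dots> = det ?M - u \<bullet> (adj_mat ?M *\<^sub>v - w)"
    using M u w by (subst det_minus_outer_prod[of _ n]) auto
  also have "adj_mat ?M *\<^sub>v - w = - (adj_mat ?M *\<^sub>v w)"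
    using adj_mat(1)[OF M] w by (intro eq_vecI) auto
  also have "u \<bullet> - (adj_mat ?M *\<^sub>v w) = - (u \<bullet> (adj_mat ?M *\<^sub>v w))"
    using adj_mat(1)[OF M] u by simp
  finally show ?thesis
    by (simp add: poly_char_poly[OF A])
qed

section \<open>Adjugate and inverse; derivatives of polynomials at zero\<close>

text \<open>A nonzero determinant makes \<open>mat_inverse\<close> return a value, so
  \<open>the\<close> is well defined. The second claim follows by multiplying the adjugate by
  \<open>A * inv_mat A\<close> and reassociating.\<close>

lemma inv_mat:
  fixes A :: "'a :: field mat"
  assumes A: "A \<in> carrier_mat n n" and d: "det A \<noteq> 0"
  shows "inv_mat A \<in> carrier_mat n n" "adj_mat A = det A \<cdot>\<^sub>m inv_mat A"
proof -
  obtain B where "mat_inverse A = Some B"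
    \<comment> \<open>The argument \<open>()\<close> fills the extension slot of the matrix ring
      record, so that both facts speak of units of the same ring.\<close>
    using mat_inverse(1)[OF A, of "()"] det_non_zero_imp_unit[OF A d, of "()"]
    by (cases "mat_inverse A") auto
  with mat_inverse(2)[OF A this] 
  have B: "inv_mat A \<in> carrier_mat n n" "A * inv_mat A = 1\<^sub>m n"
    by (auto simp: inv_mat_def)
  show "inv_mat A \<in> carrier_mat n n" by (rule B(1))
  have "adj_mat A = adj_mat A * (A * inv_mat A)"
    using adj_mat(1)[OF A] B by simp
  also have "\<dots> = (adj_mat A * A) * inv_mat A"
    using A adj_mat(1)[OF A] B by simp
  also have "\<dots> = det A \<cdot>\<^sub>m inv_mat A"
    unfolding adj_mat(3)[OF A] using B(1) by (simp add: mult_smult_assoc_mat[of _ n n _ n])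
  finally show "adj_mat A = det A \<cdot>\<^sub>m inv_mat A" .
qed

lemma higher_deriv_poly:
  fixes p :: "'a :: real_normed_field poly"
  shows "(deriv ^^ m) (poly p) = poly ((pderiv ^^ m) p)"
proof (induction m)
  case (Suc m)
  have "deriv (poly q) = poly (pderiv q)" for q :: "'a poly"
    by (intro ext DERIV_imp_deriv poly_DERIV)
  then show ?case by (simp add: Suc)
qed simp

text \<open>This is Taylor's formula at 0: differentiating \<open>m\<close> times moves the
  coefficient of degree \<open>m\<close> to the constant term and multiplies it by
  \<open>fact m\<close>.\<close>

lemma higher_deriv_poly_0:
  fixes p :: "'a :: real_normed_field poly"
  shows "(deriv ^^ m) (poly p) 0 = fact m * poly.coeff p m"
  unfolding higher_deriv_poly by (simp add: poly_0_coeff_0 coeff_higher_pderiv pochhammer_fact)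

section \<open>Positive determinants from positive quadratic forms\<close>

lemma det_pos_if_quadratic_form_pos:
  fixes A :: "real mat"
  assumes A: "A \<in> carrier_mat n n"
    and pos: "\<And>x. x \<in> carrier_vec n \<Longrightarrow> x \<noteq> 0\<^sub>v n \<Longrightarrow> x \<bullet> (A *\<^sub>v x) > 0"
  shows "det A > 0"
proof -
  \<comment> \<open>\<open>det (t I + A)\<close> is monic in \<open>t\<close> and has no zero with \<open>t \<ge> 0\<close>, so it is positive at \<open>0\<close>.\<close>
  let ?p = "char_poly (- A)"
  have A': "- A \<in> carrier_mat n n" using A by simp
  have p: "poly ?p t = det (t \<cdot>\<^sub>m 1\<^sub>m n + A)" for t
    unfolding poly_char_poly[OF A'] using A by (intro arg_cong[where f = det] eq_matI) auto
  have nonzero: "poly ?p t \<noteq> 0" if "t \<ge> 0" for t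
  proof
    assume "poly ?p t = 0"
    then have "det (t \<cdot>\<^sub>m 1\<^sub>m n + A) = 0" by (simp add: p)
    then obtain x where x: "x \<in> carrier_vec n" "x \<noteq> 0\<^sub>v n" "(t \<cdot>\<^sub>m 1\<^sub>m n + A) *\<^sub>v x = 0\<^sub>v n"
      using det_0_iff_vec_prod_zero_field[of "t \<cdot>\<^sub>m 1\<^sub>m n + A" n] A by auto
    have "(t \<cdot>\<^sub>m 1\<^sub>m n + A) *\<^sub>v x = t \<cdot>\<^sub>v x + A *\<^sub>v x"
      using A x(1)
      by (intro eq_vecI) (simp_all add: add_scalar_prod_distrib[of _ n] scalar_prod_smult_left)
    then have "t \<cdot>\<^sub>v x + A *\<^sub>v x = 0\<^sub>v n"
      using x(3) by simp
    \<comment> \<open>Pairing the kernel vector with itself gives a nonnegative term plus a positive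
      one, which cannot vanish.\<close>
    then have "0 = x \<bullet> (t \<cdot>\<^sub>v x + A *\<^sub>v x)"
      using x(1) by (simp del: carrier_vec_dim_vec)
    also have "\<dots> = t * (x \<bullet> x) + x \<bullet> (A *\<^sub>v x)"
      using A x(1) by (simp add: scalar_prod_add_distrib[of _ n])
    also have "\<dots> > 0"
      using that pos[OF x(1,2)] by (intro add_nonneg_pos) (simp_all add: scalar_prod_def sum_nonneg)
    finally show False by simp
  qed
  have "lead_coeff ?p > 0" using degree_monic_char_poly[OF A'] by simp
  from poly_pinfty_gt_lc[OF this] obtain b where "\<forall>x\<ge>b. poly ?p x > 0"
    using \<open>lead_coeff ?p > 0\<close> by (auto intro: less_le_trans)
  \<comment> \<open>The maximum with 1 keeps the right endpoint strictly above 0, as the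
    intermediate value theorem requires.\<close>
  then have b: "poly ?p (max b 1) > 0" by simp
  have "poly ?p 0 > 0"
  proof (rule ccontr)
    assume "\<not> poly ?p 0 > 0"
    then have "poly ?p 0 < 0" using nonzero[of 0] by simp
    then obtain x where "0 < x" "poly ?p x = 0"
      using poly_IVT_pos[of 0 "max b 1" ?p] b by (auto simp: less_max_iff_disj)
    then show False using nonzero[of x] by simp
  qed
  moreover have "poly ?p 0 = det A"
    unfolding p using A by (intro arg_cong[where f = det] eq_matI) auto
  ultimately show ?thesis by simp
qed

section \<open>Rank-one updates of principal minors\<close>

text \<open>Restricting an outer product to \<open>S\<close> restricts both vectors, so every
  principal submatrix undergoes a rank-one update to which the determinant lemma applies.\<close>

lemma principal_submat_minus_outer_prod:
  fixes A :: "'a :: comm_ring_1 mat"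
  assumes A: "A \<in> carrier_mat n n" and S: "S \<subseteq> {..<n}"
    and u: "u \<in> carrier_vec n" and w: "w \<in> carrier_vec n"
  shows "principal_submat (A - outer_prod w u) S = principal_submat A S
    - outer_prod ((sampling_mat n S)\<^sup>T *\<^sub>v w) ((sampling_mat n S)\<^sup>T *\<^sub>v u)"
proof -
  have pick: "pick S i < n" if "i < card S" for i
    using pick_in_set_le[OF that] S by auto
  note B = minus_outer_prod_carrier[OF w u, of A]
  note carriers = principal_submat_carrier[OF A S] principal_submat_carrier[OF B S]
  have outer: "outer_prod w u $$ (i, j) = w $ i * u $ j" if "i < n" "j < n" for i j
    using u w that by (simp add: outer_prod_def)
  show ?thesis
    unfolding transpose_sampling_mat_mult_vec[OF S u] transpose_sampling_mat_mult_vec[OF S w]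
    by (rule eq_matI)
      (use carriers A outer_prod_carrier[OF w u] pick in
        \<open>auto simp: principal_submat_index[OF A S] principal_submat_index[OF B S] outer
          outer_prod_def[of "vec _ _"]\<close>)
qed

text \<open>Both coefficients are sums of minors over the same subsets, so the determinant lemma
  applies term by term. Nonzero minors allow each adjugate to be written as determinant times
  inverse.\<close>

lemma e_coeff_diff_outer_prod:
  fixes A :: "'a :: field mat"
  assumes A: "A \<in> carrier_mat n n" and k: "k \<le> n"
    and u: "u \<in> carrier_vec n" and w: "w \<in> carrier_vec n"
    and minors: "\<And>S. S \<subseteq> {..<n} \<Longrightarrow> card S = k \<Longrightarrow> det (principal_submat A S) \<noteq> 0"
  shows "e_coeff k A - e_coeff k (A - outer_prod w u) =
    (\<Sum>S | S \<subseteq> {..<n} \<and> card S = k. det (principal_submat A S) *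
      (u \<bullet> (sampling_mat n S *\<^sub>v
        (inv_mat (principal_submat A S) *\<^sub>v ((sampling_mat n S)\<^sup>T *\<^sub>v w)))))"
proof -
  have "det (principal_submat A S) - det (principal_submat (A - outer_prod w u) S) =
      det (principal_submat A S) * (u \<bullet> (sampling_mat n S *\<^sub>v
        (inv_mat (principal_submat A S) *\<^sub>v ((sampling_mat n S)\<^sup>T *\<^sub>v w))))"
    if S: "S \<subseteq> {..<n}" "card S = k" for S
  proof -
    let ?C = "sampling_mat n S :: 'a mat" and ?B = "principal_submat A S"
    note C = sampling_mat_carrier[OF S(1), where 'a = 'a]
    note B = principal_submat_carrier[OF A S(1)]
    note inv = inv_mat[OF B minors[OF S]]
    have Cu: "?C\<^sup>T *\<^sub>v u \<in> carrier_vec (card S)" and Cw: "?C\<^sup>T *\<^sub>v w \<in> carrier_vec (card S)"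
      using C u w by auto
    have x: "inv_mat ?B *\<^sub>v (?C\<^sup>T *\<^sub>v w) \<in> carrier_vec (card S)"
      using inv(1) Cw by simp
    have "det ?B - det (principal_submat (A - outer_prod w u) S)
        = (?C\<^sup>T *\<^sub>v u) \<bullet> (adj_mat ?B *\<^sub>v (?C\<^sup>T *\<^sub>v w))"
      by (simp add: principal_submat_minus_outer_prod[OF A S(1) u w] det_minus_outer_prod[OF B Cu Cw])
    also have "adj_mat ?B *\<^sub>v (?C\<^sup>T *\<^sub>v w) = det ?B \<cdot>\<^sub>v (inv_mat ?B *\<^sub>v (?C\<^sup>T *\<^sub>v w))"
      unfolding inv(2) using inv(1) Cw by (intro eq_vecI) (auto simp: smult_scalar_prod_distrib[of _ "card S"])
    also have "(?C\<^sup>T *\<^sub>v u) \<bullet> (det ?B \<cdot>\<^sub>v (inv_mat ?B *\<^sub>v (?C\<^sup>T *\<^sub>v w)))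
        = det ?B * ((?C\<^sup>T *\<^sub>v u) \<bullet> (inv_mat ?B *\<^sub>v (?C\<^sup>T *\<^sub>v w)))"
      by (rule scalar_prod_smult_distrib[OF Cu x])
    \<comment> \<open>The sampling matrix moves from \<open>u\<close> to the other side of the
      scalar product.\<close>
    finally show ?thesis
      by (simp only: transpose_vec_mult_scalar[OF C x u])
  qed
  then show ?thesis
    unfolding e_coeff_principal_minors[OF A k]
      e_coeff_principal_minors[OF minus_outer_prod_carrier[OF w u] k]
    by (simp flip: sum_subtractf)
qed

section \<open>Positive principal minors and the k-DPP distribution\<close>

text \<open>The quadratic form of the principal submatrix at \<open>x\<close> is that of
  \<open>K\<close> at \<open>?C *\<^sub>v x\<close>, and the latter vector is nonzero because the
  columns of \<open>?C\<close> are distinct unit vectors.\<close>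

lemma det_principal_submat_pos:
  assumes K: "sym_pos_def n K" and S: "S \<subseteq> {..<n}"
  shows "det (principal_submat K S) > 0"
proof (rule det_pos_if_quadratic_form_pos)
  let ?C = "sampling_mat n S :: real mat"
  have Kc: "K \<in> carrier_mat n n" using K by (simp add: sym_pos_def_def)
  note C = sampling_mat_carrier[OF S, where 'a = real]
  show "principal_submat K S \<in> carrier_mat (card S) (card S)"
    by (rule principal_submat_carrier[OF Kc S])
  fix x :: "real vec"
  assume x: "x \<in> carrier_vec (card S)" and nz: "x \<noteq> 0\<^sub>v (card S)"
  have Cx: "?C *\<^sub>v x \<in> carrier_vec n" using C x by simp
  have "?C *\<^sub>v x \<noteq> 0\<^sub>v n"
  proof
    assume zero: "?C *\<^sub>v x = 0\<^sub>v n"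
    have "x = 0\<^sub>v (card S)"
    proof (rule eq_vecI)
      fix j assume "j < dim_vec (0\<^sub>v (card S) :: real vec)"
      then have j: "j < card S" by simp
      have pick: "pick S j < n" using pick_in_set_le[OF j] S by auto
      have "inj_on (pick S) {..<card S}"
        using bij_betw_pick[OF finite_subset[OF S finite_lessThan]] by (simp add: bij_betw_def)
      then have eq: "pick S j = pick S i \<longleftrightarrow> j = i" if "i < card S" for i
        using that j by (simp add: inj_on_eq_iff)
      \<comment> \<open>Only the term with \<open>i = j\<close> survives, so this coordinate is
        \<open>x $ j\<close>.\<close>
      have "(?C *\<^sub>v x) $ pick S j = (\<Sum>i\<in>{0..<card S}. ?C $$ (pick S j, i) * x $ i)"
        using C x pick by (simp add: scalar_prod_def)
      also have "\<dots> = (\<Sum>i\<in>{0..<card S}. if j = i then x $ i else 0)"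
        using pick by (intro sum.cong) (auto simp: sampling_mat_index[OF S] eq)
      finally have "(?C *\<^sub>v x) $ pick S j = (\<Sum>i\<in>{0..<card S}. if j = i then x $ i else 0)" .
      then show "x $ j = 0\<^sub>v (card S) $ j"
        using j pick zero by simp
    qed (use x in simp)
    with nz show False by contradiction
  qed
  then have "0 < (?C *\<^sub>v x) \<bullet> (K *\<^sub>v (?C *\<^sub>v x))"
    using K Cx by (simp add: sym_pos_def_def)
  also have "\<dots> = (?C\<^sup>T *\<^sub>v (K *\<^sub>v (?C *\<^sub>v x))) \<bullet> x"
    using C Kc Cx x
    by (subst transpose_vec_mult_scalar[OF C x]) (auto intro: comm_scalar_prod[of _ n])
  also have "\<dots> = x \<bullet> (?C\<^sup>T *\<^sub>v (K *\<^sub>v (?C *\<^sub>v x)))"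
    using C Kc x by (intro comm_scalar_prod[of _ "card S"]) auto
  also have "?C\<^sup>T *\<^sub>v (K *\<^sub>v (?C *\<^sub>v x)) = principal_submat K S *\<^sub>v x"
    using C Kc x unfolding principal_submat_def
    by (simp add: assoc_mult_mat_vec[of _ "card S" n _ "card S"] assoc_mult_mat_vec[of _ "card S" n _ n])
  finally show "0 < x \<bullet> (principal_submat K S *\<^sub>v x)" .
qed

text \<open>A sum of positive minors, nonempty since \<open>{..<k}\<close> is an admissible
  subset.\<close>

lemma e_coeff_pos:
  assumes K: "sym_pos_def n K" and k: "k \<le> n"
  shows "e_coeff k K > 0"
proof -
  have "K \<in> carrier_mat n n" using K by (simp add: sym_pos_def_def)
  moreover have "{S. S \<subseteq> {..<n} \<and> card S = k} \<noteq> {}"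
    using k by (auto intro!: exI[of _ "{..<k}"])
  ultimately show ?thesis
    using k det_principal_submat_pos[OF K]
    by (auto simp: e_coeff_principal_minors intro!: sum_pos)
qed

text \<open>The masses are nonnegative by positivity of the minors, and they sum to 1 because
  \<open>e_coeff k K\<close> is the sum of the minors of size \<open>k\<close>.\<close>

lemma pmf_kDPP:
  assumes K: "sym_pos_def n K" and k: "k \<le> n"
  shows "pmf (kDPP k K) S =
    (if S \<subseteq> {..<n} \<and> card S = k then det (principal_submat K S) / e_coeff k K else 0)"
proof -
  have Kc: "K \<in> carrier_mat n n" using K by (simp add: sym_pos_def_def)
  have e: "e_coeff k K > 0" by (rule e_coeff_pos[OF K k])
  let ?f = "\<lambda>S. if S \<subseteq> {..<n} \<and> card S = k then det (principal_submat K S) / e_coeff k K else 0"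
  have nonneg: "?f S \<ge> 0" for S
    using det_principal_submat_pos[OF K, of S] e by auto
  let ?A = "{S. S \<subseteq> {..<n} \<and> card S = k}"
  have "(\<integral>\<^sup>+S. ennreal (?f S) \<partial>count_space UNIV) = (\<Sum>S\<in>?A. ennreal (?f S))"
    by (intro nn_integral_count_space') (auto simp del: ennreal_eq_0_iff)
  also have "\<dots> = ennreal (\<Sum>S\<in>?A. ?f S)"
    by (rule sum_ennreal[OF nonneg])
  also have "(\<Sum>S\<in>?A. ?f S) = 1"
    using e by (simp add: e_coeff_principal_minors[OF Kc k] flip: sum_divide_distrib)
  finally have "(\<integral>\<^sup>+S. ennreal (?f S) \<partial>count_space UNIV) = 1" by simp
  then show ?thesis
    using nonneg Kc unfolding kDPP_def by (subst pmf_embed_pmf) auto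
qed

section \<open>The expectation and its derivative formula\<close>

theorem lemma1:
  fixes n k :: nat and K :: "real mat" and u w :: "real vec"
  assumes K: "sym_pos_def n K"
    and k: "1 \<le> k" "k \<le> n"
    and u: "u \<in> carrier_vec n"
    and w: "w \<in> carrier_vec n"
  shows "measure_pmf.expectation (kDPP k K)
           (\<lambda>S. u \<bullet> (sampling_mat n S *\<^sub>v
                  (inv_mat (principal_submat K S) *\<^sub>v ((sampling_mat n S)\<^sup>T *\<^sub>v w))))
         = (e_coeff k K - e_coeff k (K - outer_prod w u)) / e_coeff k K
       \<and> (e_coeff k K - e_coeff k (K - outer_prod w u)) / e_coeff k K
         = (-1) ^ (k + 1) / fact (n - k) *
           (deriv ^^ (n - k)) (\<lambda>t. u \<bullet> (adj_mat (t \<cdot>\<^sub>m 1\<^sub>m n - K) *\<^sub>v w) / e_coeff k K) 0"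
proof
  have Kc: "K \<in> carrier_mat n n" using K by (simp add: sym_pos_def_def)
  let ?A = "{S. S \<subseteq> {..<n} \<and> card S = k}"
  let ?g = "\<lambda>S. u \<bullet> (sampling_mat n S *\<^sub>v
    (inv_mat (principal_submat K S) *\<^sub>v ((sampling_mat n S)\<^sup>T *\<^sub>v w)))"
  \<comment> \<open>The support lies in the finite set \<open>?A\<close>, so the expectation is a
    finite sum.\<close>
  have "measure_pmf.expectation (kDPP k K) ?g = (\<Sum>S\<in>?A. ?g S * pmf (kDPP k K) S)"
    by (rule integral_measure_pmf_real) (auto simp: set_pmf_eq pmf_kDPP[OF K k(2)] split: if_splits)
  also have "\<dots> = (\<Sum>S\<in>?A. det (principal_submat K S) * ?g S) / e_coeff k K"
    by (simp add: pmf_kDPP[OF K k(2)] sum_divide_distrib mult.commute)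
  also have "(\<Sum>S\<in>?A. det (principal_submat K S) * ?g S) = e_coeff k K - e_coeff k (K - outer_prod w u)"
    using e_coeff_diff_outer_prod[OF Kc k(2) u w] det_principal_submat_pos[OF K]
    by (simp add: less_imp_neq[THEN not_sym])
  finally show "measure_pmf.expectation (kDPP k K) ?g =
      (e_coeff k K - e_coeff k (K - outer_prod w u)) / e_coeff k K" .
next
  have Kc: "K \<in> carrier_mat n n" using K by (simp add: sym_pos_def_def)
  let ?e = "e_coeff k K"
  \<comment> \<open>The function to be differentiated is the polynomial \<open>q\<close>, so its
    derivative of order \<open>n - k\<close> at 0 is \<open>fact (n - k)\<close> times one
    coefficient.\<close>
  define q where "q = Polynomial.smult (1 / ?e) (char_poly (K - outer_prod w u) - char_poly K)"
  have "(\<lambda>t. u \<bullet> (adj_mat (t \<cdot>\<^sub>m 1\<^sub>m n - K) *\<^sub>v w) / ?e) = poly q"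
    by (rule ext) (simp add: q_def char_poly_minus_outer_prod[OF Kc u w])
  moreover have "poly.coeff q (n - k) = (-1) ^ k * (e_coeff k (K - outer_prod w u) - ?e) / ?e"
    by (simp add: q_def coeff_char_poly[OF Kc] coeff_char_poly[OF minus_outer_prod_carrier[OF w u]]
        right_diff_distrib diff_divide_distrib)
  \<comment> \<open>The factorials cancel and the two factors \<open>(-1) ^ k\<close> square away;
    the remaining factor -1 reverses the difference.\<close>
  ultimately show "(?e - e_coeff k (K - outer_prod w u)) / ?e = (-1) ^ (k + 1) / fact (n - k) *
      (deriv ^^ (n - k)) (\<lambda>t. u \<bullet> (adj_mat (t \<cdot>\<^sub>m 1\<^sub>m n - K) *\<^sub>v w) / ?e) 0"
    by (simp add: higher_deriv_poly_0 diff_divide_distrib right_diff_distrib flip: mult.assoc power_add)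
qed

end
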